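(* Let $k\ge 2$ and let $\mathcal F_1,\dots,\mathcal F_k$ be (non-empty) fractions of the full factorial design $\mathcal D$, with $n_1,\dots,n_k$ design points, respectively (counted with multiplicity). Let $R_i=\sum_{\alpha\in L}c_\alpha^{(i)}X^\alpha$ be the counting function of $\mathcal F_i$, $i=1,\dots,k$. Let $\mathcal F=\mathcal F_1\cup\cdots\cup\mathcal F_k$ be their union as multisets, i.e. the fraction whose counting function is $R=\sum_{i=1}^k R_i$, and let $n=n_1+\cdots+n_k$ be its size. Then the $j$-th element of the generalized word-length pattern of $\mathcal F$ is $$A_j(\mathcal F)=\sum_{i=1}^k\frac{n_i^2}{n^2}A_j(\mathcal F_i)+2\,\frac{(\#\mathcal D)^2}{n^2}\sum_{1\le i_1<i_2\le k}\ \sum_{\alpha\in L,\ |\alpha|_0=j}\operatorname{Re}\!\left(c_\alpha^{(i_1)}\,\overline{c_\alpha^{(i_2)}}\right),\qquad j=0,\dots,m.$$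
   Context: Let $m\ge1$ and let $s_1,\dots,s_m$ be positive integers. For $j=1,\dots,m$ let $\mathcal D_j\subset\mathbb C$ be the set of the $s_j$-th roots of unity, and let $\mathcal D=\mathcal D_1\times\cdots\times\mathcal D_m$ be the full factorial design, with $\#\mathcal D=\prod_j s_j$. A fraction $\mathcal F$ of $\mathcal D$ is a finite multiset of elements of $\mathcal D$; its size $\#\mathcal F$ is the number of its elements counted with multiplicity. Let $L=\mathbb Z_{s_1}\times\cdots\times\mathbb Z_{s_m}$ and, for $\alpha\in L$, let $X^\alpha:\mathcal D\to\mathbb C$, $X^\alpha(\zeta)=\zeta_1^{\alpha_1}\cdots\zeta_m^{\alpha_m}$. The functions $X^\alpha$, $\alpha\in L$, form a basis of the complex functions on $\mathcal D$. The counting function $R:\mathcal D\to\mathbb C$ of $\mathcal F$ is the function such that $R(\zeta)$ is the number of appearances of $\zeta$ in $\mathcal F$; it is written uniquely as $R=\sum_{\alpha\in L}c_\alpha X^\alpha$ with $c_\alpha\in\mathbb C$. In particular $c_0:=c_{(0,\dots,0)}=\#\mathcal F/\#\mathcal D$. For $\alpha\in L$ let $|\alpha|_0$ be the number of non-zero components of $\alpha$. For a non-empty fraction $\mathcal F$, the aberration of $X^\alpha$ is $a_\alpha=(|c_\alpha|/c_0)^2$, and the generalized word-length pattern of $\mathcal F$ is $(A_0(\mathcal F),\dots,A_m(\mathcal F))$ with $A_j(\mathcal F)=\sum_{|\alpha|_0=j}a_\alpha$. *)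

theory Defs
  imports "HOL-Analysis.Analysis" "HOL-Library.Multiset"
begin

text \<open>
  Points and exponents are indexed by \<open>{1..m}\<close> and represented as extensional functions
  (equal to \<^const>\<open>undefined\<close> outside \<open>{1..m}\<close>), so that each mathematical tuple has exactly one
  representative.
\<close>

definition full_design :: "nat \<Rightarrow> (nat \<Rightarrow> nat) \<Rightarrow> (nat \<Rightarrow> complex) set" where
  "full_design m s = (\<Pi>\<^sub>E j\<in>{1..m}. {z. z ^ s j = 1})"

definition is_fraction :: "nat \<Rightarrow> (nat \<Rightarrow> nat) \<Rightarrow> (nat \<Rightarrow> complex) multiset \<Rightarrow> bool" where
  "is_fraction m s F \<longleftrightarrow> set_mset F \<subseteq> full_design m s"

text \<open>
  The residue ring modulo \<open>s j\<close> is represented by \<open>{0..<s j}\<close>; this is harmless because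
  \<open>z ^ s j = 1\<close> makes \<open>z ^ a\<close> depend only on \<open>a\<close> modulo \<open>s j\<close>.
\<close>

definition exponents :: "nat \<Rightarrow> (nat \<Rightarrow> nat) \<Rightarrow> (nat \<Rightarrow> nat) set" where
  "exponents m s = (\<Pi>\<^sub>E j\<in>{1..m}. {0..<s j})"

definition zero_exponent :: "nat \<Rightarrow> nat \<Rightarrow> nat" where
  "zero_exponent m = (\<lambda>j\<in>{1..m}. 0)"

definition weight :: "nat \<Rightarrow> (nat \<Rightarrow> nat) \<Rightarrow> nat" where
  "weight m \<alpha> = card {j\<in>{1..m}. \<alpha> j \<noteq> 0}"

definition monomial :: "nat \<Rightarrow> (nat \<Rightarrow> nat) \<Rightarrow> (nat \<Rightarrow> complex) \<Rightarrow> complex" where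
  "monomial m \<alpha> \<zeta> = (\<Prod>j\<in>{1..m}. \<zeta> j ^ \<alpha> j)"

definition counting_function :: "(nat \<Rightarrow> complex) multiset \<Rightarrow> (nat \<Rightarrow> complex) \<Rightarrow> complex" where
  "counting_function F \<zeta> = of_nat (count F \<zeta>)"

text \<open>
  The coefficient family is pinned down outside \<open>exponents m s\<close> by extensionality. On
  \<open>exponents m s\<close> it is determined by \<open>F\<close> because, for positive \<open>s j\<close>, the monomials form a basis
  of the complex functions on the full design; hence the description below is proper.
\<close>

definition coefficient ::
    "nat \<Rightarrow> (nat \<Rightarrow> nat) \<Rightarrow> (nat \<Rightarrow> complex) multiset \<Rightarrow> (nat \<Rightarrow> nat) \<Rightarrow> complex" where
  "coefficient m s F =
    (THE c. c \<in> extensional (exponents m s) \<and>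
       (\<forall>\<zeta>\<in>full_design m s.
          counting_function F \<zeta> = (\<Sum>\<alpha>\<in>exponents m s. c \<alpha> * monomial m \<alpha> \<zeta>)))"

definition aberration ::
    "nat \<Rightarrow> (nat \<Rightarrow> nat) \<Rightarrow> (nat \<Rightarrow> complex) multiset \<Rightarrow> (nat \<Rightarrow> nat) \<Rightarrow> real" where
  "aberration m s F \<alpha> =
    (cmod (coefficient m s F \<alpha>) / Re (coefficient m s F (zero_exponent m)))\<^sup>2"
    \<comment> \<open>the coefficient at zero is real: it equals \<open>size F / card (full_design m s)\<close>\<close>

definition word_length_pattern ::
    "nat \<Rightarrow> (nat \<Rightarrow> nat) \<Rightarrow> (nat \<Rightarrow> complex) multiset \<Rightarrow> nat \<Rightarrow> real" where
  "word_length_pattern m s F j =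
    (\<Sum>\<alpha>\<in>{\<alpha>\<in>exponents m s. weight m \<alpha> = j}. aberration m s F \<alpha>)"

end

theory Submission
  imports Defs
begin

text \<open>
  The identity is the expansion of a squared modulus, once three facts about the coefficients of a
  fraction are known: they depend additively on the fraction, they are given by the Fourier formula
  \<open>c\<^sub>\<alpha> = (1 / #D) \<Sum>\<^sub>\<zeta> R(\<zeta>) cnj (X\<^sup>\<alpha>(\<zeta>))\<close>, and consequently \<open>c\<^sub>0 = #F / #D\<close>. By the last one,
  \<open>n\<^sup>2 a\<^sub>\<alpha> = (#D)\<^sup>2 |c\<^sub>\<alpha>|\<^sup>2\<close> for every non-empty fraction of size \<open>n\<close>
  (\<open>scaled_word_length_pattern\<close>). For the union, \<open>c\<^sub>\<alpha>\<close> is the sum of the coefficients of the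
  parts, so \<open>|c\<^sub>\<alpha>|\<^sup>2\<close> splits into the squares, which give the patterns of the parts, and twice
  the real parts of the mixed products (\<open>cmod_sum_squared\<close>).

  The Fourier formula is where the roots of unity enter. It is a statement about the character
  table \<open>X\<^sup>\<alpha>(\<zeta>)\<close>, whose columns (indexed by \<open>\<alpha>\<close>) and rows (indexed by \<open>\<zeta>\<close>) are both orthogonal.
  Orthogonality of the columns shows that an expansion is unique, orthogonality of the rows that the
  Fourier coefficients do give an expansion. Both relations factor over the coordinates and so
  reduce to the case of a single cyclic group, which is a geometric sum.
\<close>

section \<open>Orthogonality for a single cyclic group\<close>

lemma cnj_root_of_unity:
  fixes z :: complex
  assumes "z ^ r = 1" and "r > 0"
  shows "z * cnj z = 1"
proof -
  have "norm z ^ r = 1"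
    using assms(1) by (metis norm_one norm_power)
  then have "norm z = 1"
    using assms(2) power_eq_imp_eq_base [of "norm z" r 1] by simp
  then show ?thesis
    by (simp add: complex_norm_square [symmetric])
qed

text \<open>
  The ratio \<open>z * cnj w\<close> of the two roots is itself a root of unity, different from 1 unless
  \<open>z = w\<close>, so the geometric sum of its powers vanishes.
\<close>

lemma sum_exponents_roots_of_unity:
  fixes z w :: complex
  assumes "r > 0" and z: "z ^ r = 1" and w: "w ^ r = 1"
  shows "(\<Sum>a<r. z ^ a * cnj (w ^ a)) = (if z = w then of_nat r else 0)"
proof (cases "z = w")
  case True
  then show ?thesis
    using cnj_root_of_unity [OF w \<open>r > 0\<close>] by (simp flip: power_mult_distrib)
next
  case False
  have "z * cnj w \<noteq> 1"
    using False cnj_root_of_unity [OF w \<open>r > 0\<close>]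
    by (metis mult.assoc mult.commute mult_1)
  moreover have "(z * cnj w) ^ r = 1"
    using z w by (simp add: power_mult_distrib flip: complex_cnj_power)
  ultimately have "(\<Sum>a<r. (z * cnj w) ^ a) = 0"
    by (simp add: geometric_sum)
  then show ?thesis
    using False by (simp add: power_mult_distrib)
qed

text \<open>
  The character table of a cyclic group is symmetric: with the roots enumerated as
  \<open>cis (2 * pi * l / r)\<close>, the \<open>a\<close>-th power of the \<open>l\<close>-th root is the \<open>l\<close>-th power of the \<open>a\<close>-th
  root. The sum over the roots is therefore the sum over the exponents treated before.
\<close>

lemma sum_roots_of_unity_powers:
  assumes "r > 0" and "a < r" and "b < r"
  shows "(\<Sum>z | z ^ r = 1. z ^ a * cnj (z ^ b)) = (if a = b then of_nat r else (0::complex))"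
proof -
  define \<omega> where "\<omega> l = cis (2 * pi * real l / real r)" for l
  have bij: "bij_betw \<omega> {..<r} {z. z ^ r = 1}"
    unfolding \<omega>_def using Complex.bij_betw_roots_unity [OF \<open>r > 0\<close>] .
  have swap: "\<omega> l ^ c = \<omega> c ^ l" for l c
    unfolding \<omega>_def Complex.DeMoivre by (simp add: mult_ac)
  have root: "\<omega> c ^ r = 1" if "c < r" for c
    using bij_betwE [OF bij] that by auto
  have "(\<Sum>z | z ^ r = 1. z ^ a * cnj (z ^ b)) = (\<Sum>l<r. \<omega> l ^ a * cnj (\<omega> l ^ b))"
    by (rule sum.reindex_bij_betw [OF bij, symmetric])
  also have "\<dots> = (\<Sum>l<r. \<omega> a ^ l * cnj (\<omega> b ^ l))"
    by (simp only: swap [of _ a] swap [of _ b])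
  also have "\<dots> = (if \<omega> a = \<omega> b then of_nat r else 0)"
    using assms by (intro sum_exponents_roots_of_unity root)
  also have "\<omega> a = \<omega> b \<longleftrightarrow> a = b"
    using bij_betw_imp_inj_on [OF bij] assms by (auto simp: inj_on_def)
  finally show ?thesis .
qed

section \<open>Orthogonality for the full design\<close>

lemma finite_roots_of_unity:
  assumes "r > 0"
  shows "finite {z::complex. z ^ r = 1}"
  using bij_betw_finite [OF Complex.bij_betw_roots_unity [OF assms]] by simp

lemma finite_exponents: "finite (exponents m s)"
  unfolding exponents_def by (intro finite_PiE) auto

text \<open>
  This collects the one-coordinate relations: a product of Kronecker deltas is the Kronecker delta
  of the tuples. Extensionality of \<open>f\<close> and \<open>g\<close> is what makes agreement on \<open>I\<close> mean equality.
\<close>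

lemma prod_Kronecker_delta:
  fixes c :: "'i \<Rightarrow> 'a::comm_semiring_1"
  assumes "finite I" and "f \<in> extensional I" and "g \<in> extensional I"
  shows "(\<Prod>i\<in>I. if f i = g i then c i else 0) = (if f = g then \<Prod>i\<in>I. c i else 0)"
proof (cases "f = g")
  case False
  then obtain i where "i \<in> I" "f i \<noteq> g i"
    using assms(2,3) by (meson extensionalityI)
  then have "(\<Prod>i\<in>I. if f i = g i then c i else 0) = 0"
    using assms(1) by (intro prod_zero) auto
  then show ?thesis
    using False by simp
qed simp

lemma monomial_mult_cnj:
  "monomial m \<alpha> \<zeta> * cnj (monomial m \<beta> \<xi>) = (\<Prod>l\<in>{1..m}. \<zeta> l ^ \<alpha> l * cnj (\<xi> l ^ \<beta> l))"
  by (simp add: monomial_def prod.distrib)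

context
  fixes m :: nat and s :: "nat \<Rightarrow> nat"
  assumes pos: "\<And>l. l \<in> {1..m} \<Longrightarrow> s l > 0"
begin

lemma finite_full_design: "finite (full_design m s)"
  unfolding full_design_def using pos by (intro finite_PiE finite_roots_of_unity) auto

lemma card_full_design: "card (full_design m s) = (\<Prod>l\<in>{1..m}. s l)"
  unfolding full_design_def using pos
  by (subst card_PiE) (auto intro!: prod.cong card_roots_unity_eq)

lemma card_full_design_pos: "card (full_design m s) > 0"
  by (simp only: card_full_design prod_pos pos)

lemma monomials_orthogonal:
  assumes \<alpha>: "\<alpha> \<in> exponents m s" and \<beta>: "\<beta> \<in> exponents m s"
  shows "(\<Sum>\<zeta>\<in>full_design m s. monomial m \<alpha> \<zeta> * cnj (monomial m \<beta> \<zeta>)) =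
    (if \<alpha> = \<beta> then of_nat (card (full_design m s)) else 0)"
proof -
  have "(\<Sum>\<zeta>\<in>full_design m s. monomial m \<alpha> \<zeta> * cnj (monomial m \<beta> \<zeta>)) =
      (\<Prod>l\<in>{1..m}. \<Sum>z | z ^ s l = 1. z ^ \<alpha> l * cnj (z ^ \<beta> l))"
    unfolding monomial_mult_cnj full_design_def
    using pos by (intro prod_sum_PiE [symmetric] finite_roots_of_unity) auto
  also have "\<dots> = (\<Prod>l\<in>{1..m}. if \<alpha> l = \<beta> l then of_nat (s l) else 0)"
    using pos \<alpha> \<beta>
    by (intro prod.cong refl sum_roots_of_unity_powers) (auto simp: exponents_def PiE_def Pi_def)
  also have "\<dots> = (if \<alpha> = \<beta> then \<Prod>l\<in>{1..m}. of_nat (s l) else 0)"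
    using \<alpha> \<beta> by (intro prod_Kronecker_delta) (auto simp: exponents_def PiE_def)
  finally show ?thesis
    by (simp add: card_full_design)
qed

lemma points_orthogonal:
  assumes \<zeta>: "\<zeta> \<in> full_design m s" and \<xi>: "\<xi> \<in> full_design m s"
  shows "(\<Sum>\<alpha>\<in>exponents m s. monomial m \<alpha> \<zeta> * cnj (monomial m \<alpha> \<xi>)) =
    (if \<zeta> = \<xi> then of_nat (card (full_design m s)) else 0)"
proof -
  have "(\<Sum>\<alpha>\<in>exponents m s. monomial m \<alpha> \<zeta> * cnj (monomial m \<alpha> \<xi>)) =
      (\<Prod>l\<in>{1..m}. \<Sum>a\<in>{0..<s l}. \<zeta> l ^ a * cnj (\<xi> l ^ a))"
    unfolding monomial_mult_cnj exponents_def by (intro prod_sum_PiE [symmetric]) auto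
  also have "\<dots> = (\<Prod>l\<in>{1..m}. if \<zeta> l = \<xi> l then of_nat (s l) else 0)"
    unfolding atLeast0LessThan using pos \<zeta> \<xi>
    by (intro prod.cong refl sum_exponents_roots_of_unity)
      (auto simp: full_design_def PiE_def Pi_def)
  also have "\<dots> = (if \<zeta> = \<xi> then \<Prod>l\<in>{1..m}. of_nat (s l) else 0)"
    using \<zeta> \<xi> by (intro prod_Kronecker_delta) (auto simp: full_design_def PiE_def)
  finally show ?thesis
    by (simp add: card_full_design)
qed

section \<open>Coefficients of a counting function\<close>

text \<open>
  Multiplying an expansion by \<open>cnj X\<^sup>\<beta>\<close> and summing over the design kills every term but the one
  at \<open>\<beta>\<close>, so an expansion, if there is one, has the Fourier coefficients.
\<close>

lemma expansion_coefficient: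
  assumes f: "\<And>\<zeta>. \<zeta> \<in> full_design m s \<Longrightarrow> f \<zeta> = (\<Sum>\<alpha>\<in>exponents m s. c \<alpha> * monomial m \<alpha> \<zeta>)"
    and \<beta>: "\<beta> \<in> exponents m s"
  shows "c \<beta> = (\<Sum>\<zeta>\<in>full_design m s. f \<zeta> * cnj (monomial m \<beta> \<zeta>)) /
    of_nat (card (full_design m s))"
proof -
  have "(\<Sum>\<zeta>\<in>full_design m s. f \<zeta> * cnj (monomial m \<beta> \<zeta>)) =
      (\<Sum>\<zeta>\<in>full_design m s. \<Sum>\<alpha>\<in>exponents m s.
        c \<alpha> * (monomial m \<alpha> \<zeta> * cnj (monomial m \<beta> \<zeta>)))"
    by (simp add: f sum_distrib_right mult.assoc)
  also have "\<dots> = (\<Sum>\<alpha>\<in>exponents m s.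
      c \<alpha> * (\<Sum>\<zeta>\<in>full_design m s. monomial m \<alpha> \<zeta> * cnj (monomial m \<beta> \<zeta>)))"
    by (subst sum.swap) (simp add: sum_distrib_left)
  also have "\<dots> = (\<Sum>\<alpha>\<in>exponents m s.
      if \<alpha> = \<beta> then c \<alpha> * of_nat (card (full_design m s)) else 0)"
    using \<beta> by (intro sum.cong refl) (simp add: monomials_orthogonal)
  also have "\<dots> = c \<beta> * of_nat (card (full_design m s))"
    using \<beta> by (simp add: finite_exponents)
  finally show ?thesis
    using card_full_design_pos by simp
qed

text \<open>
  Existence uses the dual orthogonality relation: after interchanging the sums, the inner sum over
  the exponents is \<open>#D\<close> times the indicator of \<open>\<xi> = \<zeta>\<close>.
\<close>

lemma Fourier_expansion:
  assumes \<zeta>: "\<zeta> \<in> full_design m s"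
  shows "f \<zeta> = (\<Sum>\<alpha>\<in>exponents m s.
    (\<Sum>\<xi>\<in>full_design m s. f \<xi> * cnj (monomial m \<alpha> \<xi>)) / of_nat (card (full_design m s)) *
      monomial m \<alpha> \<zeta>)" (is "_ = ?rhs")
proof -
  let ?d = "of_nat (card (full_design m s)) :: complex"
  have "?rhs = (\<Sum>\<alpha>\<in>exponents m s. \<Sum>\<xi>\<in>full_design m s.
      f \<xi> / ?d * (monomial m \<alpha> \<zeta> * cnj (monomial m \<alpha> \<xi>)))"
    by (simp add: sum_divide_distrib sum_distrib_left sum_distrib_right mult_ac)
  also have "\<dots> = (\<Sum>\<xi>\<in>full_design m s.
      f \<xi> / ?d * (\<Sum>\<alpha>\<in>exponents m s. monomial m \<alpha> \<zeta> * cnj (monomial m \<alpha> \<xi>)))"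
    by (subst sum.swap) (simp add: sum_distrib_left)
  also have "\<dots> = (\<Sum>\<xi>\<in>full_design m s. if \<zeta> = \<xi> then f \<xi> else 0)"
    using \<zeta> card_full_design_pos
    by (intro sum.cong refl) (simp add: points_orthogonal)
  also have "\<dots> = f \<zeta>"
    using \<zeta> finite_full_design by simp
  finally show ?thesis ..
qed

lemma coefficient_eq:
  assumes \<alpha>: "\<alpha> \<in> exponents m s"
  shows "coefficient m s F \<alpha> =
    (\<Sum>\<zeta>\<in>full_design m s. counting_function F \<zeta> * cnj (monomial m \<alpha> \<zeta>)) /
      of_nat (card (full_design m s))"
proof -
  define c where "c = (\<lambda>\<alpha>\<in>exponents m s.
    (\<Sum>\<zeta>\<in>full_design m s. counting_function F \<zeta> * cnj (monomial m \<alpha> \<zeta>)) /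
      of_nat (card (full_design m s)))"
  have "coefficient m s F = c"
    unfolding coefficient_def
  proof (rule the_equality)
    show "c \<in> extensional (exponents m s) \<and> (\<forall>\<zeta>\<in>full_design m s.
        counting_function F \<zeta> = (\<Sum>\<alpha>\<in>exponents m s. c \<alpha> * monomial m \<alpha> \<zeta>))"
      using Fourier_expansion [of _ "counting_function F"] by (simp add: c_def)
  next
    fix c'
    assume c': "c' \<in> extensional (exponents m s) \<and> (\<forall>\<zeta>\<in>full_design m s.
        counting_function F \<zeta> = (\<Sum>\<alpha>\<in>exponents m s. c' \<alpha> * monomial m \<alpha> \<zeta>))"
    show "c' = c"
    proof (rule extensionalityI)
      show "c' \<in> extensional (exponents m s)"
        using c' by simp
      show "c \<in> extensional (exponents m s)"
        by (simp add: c_def)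
      show "c' \<beta> = c \<beta>" if "\<beta> \<in> exponents m s" for \<beta>
        using expansion_coefficient [of "counting_function F" c' \<beta>] c' that
        by (simp add: c_def)
    qed
  qed
  then show ?thesis
    using \<alpha> by (simp add: c_def)
qed

lemma coefficient_sum:
  assumes \<alpha>: "\<alpha> \<in> exponents m s"
  shows "coefficient m s (\<Sum>i\<in>I. F i) \<alpha> = (\<Sum>i\<in>I. coefficient m s (F i) \<alpha>)"
proof -
  have "(\<Sum>\<zeta>\<in>full_design m s. counting_function (\<Sum>i\<in>I. F i) \<zeta> * cnj (monomial m \<alpha> \<zeta>)) =
      (\<Sum>i\<in>I. \<Sum>\<zeta>\<in>full_design m s. counting_function (F i) \<zeta> * cnj (monomial m \<alpha> \<zeta>))"
    by (subst sum.swap) (simp add: counting_function_def count_sum sum_distrib_right)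
  then show ?thesis
    by (simp add: coefficient_eq [OF \<alpha>] sum_divide_distrib)
qed

lemma coefficient_zero_exponent:
  assumes F: "is_fraction m s F"
  shows "coefficient m s F (zero_exponent m) =
    of_nat (size F) / of_nat (card (full_design m s))"
proof -
  have "zero_exponent m \<in> exponents m s"
    using pos by (auto simp: zero_exponent_def exponents_def)
  moreover have "monomial m (zero_exponent m) \<zeta> = 1" for \<zeta>
    by (simp add: monomial_def zero_exponent_def)
  \<comment> \<open>counting over the design reaches every element of \<open>F\<close> because \<open>F\<close> is a fraction of it\<close>
  moreover have "size F = (\<Sum>\<zeta>\<in>full_design m s. count F \<zeta>)"
    unfolding size_multiset_overloaded_eq
    using F finite_full_design
    by (intro sum.mono_neutral_left) (auto simp: is_fraction_def not_in_iff)
  ultimately show ?thesis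
    by (simp add: coefficient_eq counting_function_def)
qed

section \<open>Word-length patterns of unions\<close>

text \<open>
  Aberrations of different fractions are normalised by different values of \<open>c\<^sub>0\<close>. Clearing that
  denominator leaves the common factor \<open>(#D)\<^sup>2\<close>, after which patterns of the parts and of their
  union can be compared.
\<close>

lemma scaled_word_length_pattern:
  assumes F: "is_fraction m s F" and "F \<noteq> {#}"
  shows "(real (size F))\<^sup>2 * word_length_pattern m s F j =
    (real (card (full_design m s)))\<^sup>2 *
      (\<Sum>\<alpha>\<in>{\<alpha>\<in>exponents m s. weight m \<alpha> = j}. (cmod (coefficient m s F \<alpha>))\<^sup>2)"
proof -
  have "Re (coefficient m s F (zero_exponent m)) = real (size F) / real (card (full_design m s))"
    using coefficient_zero_exponent [OF F]
    by (metis Re_complex_of_real of_real_divide of_real_of_nat_eq)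
  moreover have "size F \<noteq> 0"
    using \<open>F \<noteq> {#}\<close> by simp
  ultimately have "(real (size F))\<^sup>2 * aberration m s F \<alpha> =
      (real (card (full_design m s)))\<^sup>2 * (cmod (coefficient m s F \<alpha>))\<^sup>2" for \<alpha>
    by (simp add: aberration_def power_divide power_mult_distrib)
  then show ?thesis
    by (simp add: word_length_pattern_def sum_distrib_left)
qed

end

lemma cmod_add_squared_Re:
  "(cmod (z + w))\<^sup>2 = (cmod z)\<^sup>2 + (cmod w)\<^sup>2 + 2 * Re (z * cnj w)"
  by (simp only: cmod_power2) (simp add: power2_eq_square algebra_simps)

lemma cmod_sum_squared:
  fixes c :: "nat \<Rightarrow> complex"
  shows "(cmod (\<Sum>i\<in>{1..k}. c i))\<^sup>2 = (\<Sum>i\<in>{1..k}. (cmod (c i))\<^sup>2) +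
    2 * (\<Sum>(i1, i2)\<in>{(i1, i2). 1 \<le> i1 \<and> i1 < i2 \<and> i2 \<le> k}. Re (c i1 * cnj (c i2)))"
proof (induction k)
  case 0
  have "{(i1, i2). 1 \<le> i1 \<and> i1 < i2 \<and> i2 \<le> (0::nat)} = {}"
    by auto
  then show ?case
    by (simp only:) simp
next
  case (Suc k)
  let ?P = "\<lambda>k. {(i1, i2). 1 \<le> i1 \<and> i1 < i2 \<and> i2 \<le> (k::nat)}"
  have P_Suc: "?P (Suc k) = ?P k \<union> {1..k} \<times> {Suc k}"
    by auto
  have P_finite: "finite (?P k)"
    by (rule finite_subset [of _ "{1..k} \<times> {1..k}"]) auto
  have "(\<Sum>(i1, i2)\<in>?P (Suc k). Re (c i1 * cnj (c i2))) =
      (\<Sum>(i1, i2)\<in>?P k. Re (c i1 * cnj (c i2))) +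
      (\<Sum>(i1, i2)\<in>{1..k} \<times> {Suc k}. Re (c i1 * cnj (c i2)))"
    unfolding P_Suc by (intro sum.union_disjoint P_finite) auto
  also have "(\<Sum>(i1, i2)\<in>{1..k} \<times> {Suc k}. Re (c i1 * cnj (c i2))) =
      (\<Sum>i\<in>{1..k}. Re (c i * cnj (c (Suc k))))"
    by (subst sum.cartesian_product [symmetric]) simp
  also have "(\<Sum>i\<in>{1..k}. Re (c i * cnj (c (Suc k)))) =
      Re ((\<Sum>i\<in>{1..k}. c i) * cnj (c (Suc k)))"
    by (simp only: sum_distrib_right Re_sum)
  finally have pairs: "(\<Sum>(i1, i2)\<in>?P (Suc k). Re (c i1 * cnj (c i2))) =
      (\<Sum>(i1, i2)\<in>?P k. Re (c i1 * cnj (c i2))) +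
      Re ((\<Sum>i\<in>{1..k}. c i) * cnj (c (Suc k)))" .
  have last: "(\<Sum>i\<in>{1..Suc k}. f i) = (\<Sum>i\<in>{1..k}. f i) + f (Suc k)"
    for f :: "nat \<Rightarrow> 'a::comm_monoid_add"
    by simp
  show ?case
    unfolding last cmod_add_squared_Re pairs Suc.IH by (simp only: distrib_left add_ac)
qed

theorem proposition7:
  fixes m k j N :: nat
    and s n :: "nat \<Rightarrow> nat"
    and F :: "nat \<Rightarrow> (nat \<Rightarrow> complex) multiset"
    and U :: "(nat \<Rightarrow> complex) multiset"
  assumes "m \<ge> 1"
    and "\<And>l. l \<in> {1..m} \<Longrightarrow> s l > 0"
    and "k \<ge> 2"
    and "\<And>i. i \<in> {1..k} \<Longrightarrow> is_fraction m s (F i)"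
    and "\<And>i. i \<in> {1..k} \<Longrightarrow> F i \<noteq> {#}"
    and "\<And>i. i \<in> {1..k} \<Longrightarrow> n i = size (F i)"
    and "U = (\<Sum>i\<in>{1..k}. F i)"
    and "N = (\<Sum>i\<in>{1..k}. n i)"
    and "j \<in> {0..m}"
  shows "word_length_pattern m s U j =
      (\<Sum>i\<in>{1..k}. (real (n i))\<^sup>2 / (real N)\<^sup>2 * word_length_pattern m s (F i) j)
      + 2 * ((real (card (full_design m s)))\<^sup>2 / (real N)\<^sup>2) *
        (\<Sum>(i1, i2)\<in>{(i1, i2). 1 \<le> i1 \<and> i1 < i2 \<and> i2 \<le> k}.
           \<Sum>\<alpha>\<in>{\<alpha>\<in>exponents m s. weight m \<alpha> = j}.
             Re (coefficient m s (F i1) \<alpha> * cnj (coefficient m s (F i2) \<alpha>)))"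
proof -
  let ?W = "{\<alpha>\<in>exponents m s. weight m \<alpha> = j}"
  let ?P = "{(i1, i2). 1 \<le> i1 \<and> i1 < i2 \<and> i2 \<le> k}"
  let ?d = "real (card (full_design m s))"
  let ?c = "\<lambda>i. coefficient m s (F i)"
  note pos = assms(2) and frac = assms(4) and ne = assms(5) and size = assms(6)
  have U_frac: "is_fraction m s U"
    unfolding \<open>U = _\<close> is_fraction_def set_mset_sum [OF finite_atLeastAtMost]
    using frac unfolding is_fraction_def by (rule UN_least)
  have U_ne: "U \<noteq> {#}"
    using ne \<open>k \<ge> 2\<close> unfolding \<open>U = _\<close> by (auto simp: sum_eq_empty_iff)
  have U_size: "size U = N"
    using size unfolding \<open>U = _\<close> \<open>N = _\<close> by simp
  have N: "N \<noteq> 0"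
    using U_ne U_size by (metis size_eq_0_iff_empty)
  have "(\<Sum>\<alpha>\<in>?W. (cmod (coefficient m s U \<alpha>))\<^sup>2) =
      (\<Sum>\<alpha>\<in>?W. (\<Sum>i\<in>{1..k}. (cmod (?c i \<alpha>))\<^sup>2) +
        2 * (\<Sum>(i1, i2)\<in>?P. Re (?c i1 \<alpha> * cnj (?c i2 \<alpha>))))"
    unfolding \<open>U = _\<close>
    by (intro sum.cong refl)
      (simp only: mem_Collect_eq coefficient_sum [of m s, OF pos] cmod_sum_squared)
  also have "\<dots> = (\<Sum>i\<in>{1..k}. \<Sum>\<alpha>\<in>?W. (cmod (?c i \<alpha>))\<^sup>2) +
      2 * (\<Sum>(i1, i2)\<in>?P. \<Sum>\<alpha>\<in>?W. Re (?c i1 \<alpha> * cnj (?c i2 \<alpha>)))"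
    unfolding sum.distrib sum_distrib_left [symmetric] case_prod_unfold
    by (simp only: sum.swap [of _ _ ?W])
  finally have squares: "(\<Sum>\<alpha>\<in>?W. (cmod (coefficient m s U \<alpha>))\<^sup>2) = \<dots>" .
  have parts: "?d\<^sup>2 * (\<Sum>\<alpha>\<in>?W. (cmod (?c i \<alpha>))\<^sup>2) =
      (real (n i))\<^sup>2 * word_length_pattern m s (F i) j"
    if "i \<in> {1..k}" for i
    using scaled_word_length_pattern [of m s, OF pos frac ne] that size by simp
  have whole: "(real N)\<^sup>2 * word_length_pattern m s U j =
      ?d\<^sup>2 * (\<Sum>\<alpha>\<in>?W. (cmod (coefficient m s U \<alpha>))\<^sup>2)"
    using scaled_word_length_pattern [of m s, OF pos U_frac U_ne] U_size by simp
  have "(real N)\<^sup>2 * word_length_pattern m s U j =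
      (\<Sum>i\<in>{1..k}. ?d\<^sup>2 * (\<Sum>\<alpha>\<in>?W. (cmod (?c i \<alpha>))\<^sup>2)) +
      2 * ?d\<^sup>2 * (\<Sum>(i1, i2)\<in>?P. \<Sum>\<alpha>\<in>?W. Re (?c i1 \<alpha> * cnj (?c i2 \<alpha>)))"
    unfolding whole squares sum_distrib_left [symmetric]
    by (simp only: distrib_left mult.left_commute mult.assoc)
  also have "(\<Sum>i\<in>{1..k}. ?d\<^sup>2 * (\<Sum>\<alpha>\<in>?W. (cmod (?c i \<alpha>))\<^sup>2)) =
      (\<Sum>i\<in>{1..k}. (real (n i))\<^sup>2 * word_length_pattern m s (F i) j)"
    by (intro sum.cong refl parts)
  finally have "word_length_pattern m s U j * (real N)\<^sup>2 =
      (\<Sum>i\<in>{1..k}. (real (n i))\<^sup>2 * word_length_pattern m s (F i) j) +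
      2 * ?d\<^sup>2 * (\<Sum>(i1, i2)\<in>?P. \<Sum>\<alpha>\<in>?W. Re (?c i1 \<alpha> * cnj (?c i2 \<alpha>)))"
    by (subst mult.commute)
  then have "word_length_pattern m s U j =
      ((\<Sum>i\<in>{1..k}. (real (n i))\<^sup>2 * word_length_pattern m s (F i) j) +
      2 * ?d\<^sup>2 * (\<Sum>(i1, i2)\<in>?P. \<Sum>\<alpha>\<in>?W. Re (?c i1 \<alpha> * cnj (?c i2 \<alpha>)))) / (real N)\<^sup>2"
    using N by (intro iffD2 [OF nonzero_eq_divide_eq]) simp_all
  then show ?thesis
    by (simp only: add_divide_distrib sum_divide_distrib times_divide_eq_left times_divide_eq_right)
qed

end
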